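(* Let $D=\{d_1,\dots,d_N\}$ be a training set of $N\ge 1$ instances, let $V$ be a real-valued performance function on the subsets of $D$, let $\tau\in\mathbb{R}$ and $\varepsilon>0$. For $n\in\{1,\dots,N\}$ and a permutation $\sigma\in S_D$ of $D$, let $\Phi_n(\sigma)=V(D'(\sigma,n)\cup\{d_n\})-V(D'(\sigma,n))$, where $D'(\sigma,n)$ is the set of instances placed before $d_n$ in $\sigma$. Put $$w:=\max_{1\le n\le N}\Big\{\max_{\sigma\in S_D}\Phi_n(\sigma)-\min_{\sigma\in S_D}\Phi_n(\sigma)\Big\}.$$ Run the TDShap algorithm (defined in the context) with threshold $\tau$ and precision $\varepsilon$ for $T$ iterations in total, and let $p_{\mathrm{fail}}$ be its probability of failure (defined in the context). If $$T\ \geq\ \frac{64Nw^2}{\varepsilon^2}\log\big(N(1+\log T)\big),$$ then $$p_{\mathrm{fail}}\ \leq\ \frac{1}{N^2(1+\log T)^2}.$$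
   Context: $D=\{d_1,\dots,d_N\}$ is a finite set of $N$ distinct (indexed) instances. For every $D'\subseteq D$ (including $\emptyset$ and $D$), $V(D')\in\mathbb{R}$ is a fixed deterministic number (the value of a higher-is-better performance metric of the model trained on $D'$). $S_D$ is the set of all $|D|!=N!$ permutations (orderings) of $D$. The data Shapley value of $d_n$ is $$\phi_n=\frac{1}{|S_D|}\sum_{\sigma\in S_D}\Phi_n(\sigma).$$ $\log$ denotes the natural logarithm. TDShap algorithm with parameters $\tau,\varepsilon$ and total number of iterations $T\ge N$ (one iteration means one evaluation of some $\Phi_n(\sigma)$; the $N$ initial evaluations are counted): 1. Initialization: for each $n=1,\dots,N$, draw $\sigma$ uniformly at random from $S_D$, set $\hat\phi_n\leftarrow\Phi_n(\sigma)$ and $T_n\leftarrow 1$. 2. For each of the remaining $T-N$ iterations: compute $B_n=\sqrt{T_n}\,(|\hat\phi_n-\tau|+\varepsilon)$ for all $n$; choose $n$ uniformly at random among the minimizers of $B_n$; draw $\sigma$ uniformly at random from $S_D$; set $\hat\phi_n\leftarrow\frac{T_n}{T_n+1}\hat\phi_n+\frac{1}{T_n+1}\Phi_n(\sigma)$ and then $T_n\leftarrow T_n+1$. 3. Output $\hat{\mathcal N}_{\mathrm{harmful}}=\{n : \hat\phi_n\le\tau\}$, using the final values $\hat\phi_n$. All the permutations drawn are mutually independent, and each is independent of the choice of index made before it and of the past. Failure is the event that there is at least one $n\in\{1,\dots,N\}$ such that either $\phi_n\le\tau-\varepsilon$ and $n\notin\hat{\mathcal N}_{\mathrm{harmful}}$,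 or $\phi_n\ge\tau+\varepsilon$ and $n\in\hat{\mathcal N}_{\mathrm{harmful}}$. $p_{\mathrm{fail}}$ is the probability of this event over the internal randomness of the algorithm. *)

theory Defs
  imports "HOL-Probability.Probability" "HOL-Combinatorics.Multiset_Permutations"
begin

text \<open>
  The data set is \<^term>\<open>D = d ` {1..N}\<close> with \<^term>\<open>d\<close> injective on \<^term>\<open>{1..N}\<close>. An ordering of
  \<^term>\<open>D\<close> is a list in \<^term>\<open>permutations_of_set D\<close>, i.e. a list that enumerates \<^term>\<open>D\<close>
  without repetition. Only the values of \<open>V\<close> on subsets of \<open>D\<close> are ever used.
\<close>

definition preceding :: "'a list \<Rightarrow> 'a \<Rightarrow> 'a set" where
  "preceding \<sigma> x = set (takeWhile (\<lambda>y. y \<noteq> x) \<sigma>)"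

definition marginal :: "('a set \<Rightarrow> real) \<Rightarrow> (nat \<Rightarrow> 'a) \<Rightarrow> nat \<Rightarrow> 'a list \<Rightarrow> real" where
  "marginal V d n \<sigma> = V (preceding \<sigma> (d n) \<union> {d n}) - V (preceding \<sigma> (d n))"

definition shapley :: "('a set \<Rightarrow> real) \<Rightarrow> 'a set \<Rightarrow> (nat \<Rightarrow> 'a) \<Rightarrow> nat \<Rightarrow> real" where
  "shapley V D d n =
     1 / real (card (permutations_of_set D)) * (\<Sum>\<sigma>\<in>permutations_of_set D. marginal V d n \<sigma>)"

definition max_range :: "('a set \<Rightarrow> real) \<Rightarrow> 'a set \<Rightarrow> (nat \<Rightarrow> 'a) \<Rightarrow> nat \<Rightarrow> real" where
  "max_range V D d N =
     (MAX n\<in>{1..N}. (MAX \<sigma>\<in>permutations_of_set D. marginal V d n \<sigma>)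
                   - (MIN \<sigma>\<in>permutations_of_set D. marginal V d n \<sigma>))"

text \<open>
  A state consists of the estimates and the evaluation counts of the indices; values at
  indices outside \<^term>\<open>{1..N}\<close> are irrelevant. The independence of all draws is
  that of \<^const>\<open>Pi_pmf\<close> and of \<^const>\<open>bind_pmf\<close> with a fixed distribution.
\<close>

type_synonym tdshap_state = "(nat \<Rightarrow> real) \<times> (nat \<Rightarrow> nat)"

definition tdshap_init ::
    "('a set \<Rightarrow> real) \<Rightarrow> 'a set \<Rightarrow> (nat \<Rightarrow> 'a) \<Rightarrow> nat \<Rightarrow> tdshap_state pmf" where
  "tdshap_init V D d N = do {
     \<sigma> \<leftarrow> Pi_pmf {1..N} [] (\<lambda>_. pmf_of_set (permutations_of_set D));
     return_pmf (\<lambda>n. marginal V d n (\<sigma> n), \<lambda>_. 1)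
   }"

definition tdshap_index :: "real \<Rightarrow> real \<Rightarrow> tdshap_state \<Rightarrow> nat \<Rightarrow> real" where
  "tdshap_index \<tau> \<epsilon> = (\<lambda>(est, cnt) n. sqrt (real (cnt n)) * (\<bar>est n - \<tau>\<bar> + \<epsilon>))"

definition tdshap_minimizers :: "nat \<Rightarrow> real \<Rightarrow> real \<Rightarrow> tdshap_state \<Rightarrow> nat set" where
  "tdshap_minimizers N \<tau> \<epsilon> s =
     {n \<in> {1..N}. \<forall>m\<in>{1..N}. tdshap_index \<tau> \<epsilon> s n \<le> tdshap_index \<tau> \<epsilon> s m}"

definition tdshap_update :: "nat \<Rightarrow> real \<Rightarrow> tdshap_state \<Rightarrow> tdshap_state" where
  "tdshap_update n x = (\<lambda>(est, cnt).
     (est(n := real (cnt n) / (real (cnt n) + 1) * est n + 1 / (real (cnt n) + 1) * x),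
      cnt(n := cnt n + 1)))"

definition tdshap_step ::
    "('a set \<Rightarrow> real) \<Rightarrow> 'a set \<Rightarrow> (nat \<Rightarrow> 'a) \<Rightarrow> nat \<Rightarrow> real \<Rightarrow> real
      \<Rightarrow> tdshap_state \<Rightarrow> tdshap_state pmf" where
  "tdshap_step V D d N \<tau> \<epsilon> s = do {
     n \<leftarrow> pmf_of_set (tdshap_minimizers N \<tau> \<epsilon> s);
     \<sigma> \<leftarrow> pmf_of_set (permutations_of_set D);
     return_pmf (tdshap_update n (marginal V d n \<sigma>) s)
   }"

primrec tdshap_steps ::
    "('a set \<Rightarrow> real) \<Rightarrow> 'a set \<Rightarrow> (nat \<Rightarrow> 'a) \<Rightarrow> nat \<Rightarrow> real \<Rightarrow> real
      \<Rightarrow> nat \<Rightarrow> tdshap_state pmf" where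
  "tdshap_steps V D d N \<tau> \<epsilon> 0 = tdshap_init V D d N"
| "tdshap_steps V D d N \<tau> \<epsilon> (Suc k) =
     bind_pmf (tdshap_steps V D d N \<tau> \<epsilon> k) (tdshap_step V D d N \<tau> \<epsilon>)"

text \<open>
  The total budget \<open>T\<close> includes the \<open>N\<close> initial evaluations, so \<open>T - N\<close> adaptive steps remain;
  the definition is only meaningful for \<^term>\<open>N \<le> T\<close>. The result is the distribution of the
  output set.
\<close>

definition tdshap ::
    "('a set \<Rightarrow> real) \<Rightarrow> 'a set \<Rightarrow> (nat \<Rightarrow> 'a) \<Rightarrow> nat \<Rightarrow> real \<Rightarrow> real
      \<Rightarrow> nat \<Rightarrow> nat set pmf" where
  "tdshap V D d N \<tau> \<epsilon> T =
     map_pmf (\<lambda>(est, cnt). {n \<in> {1..N}. est n \<le> \<tau>}) (tdshap_steps V D d N \<tau> \<epsilon> (T - N))"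

definition failure ::
    "('a set \<Rightarrow> real) \<Rightarrow> 'a set \<Rightarrow> (nat \<Rightarrow> 'a) \<Rightarrow> nat \<Rightarrow> real \<Rightarrow> real \<Rightarrow> nat set \<Rightarrow> bool" where
  "failure V D d N \<tau> \<epsilon> H \<longleftrightarrow>
     (\<exists>n\<in>{1..N}. shapley V D d n \<le> \<tau> - \<epsilon> \<and> n \<notin> H \<or> shapley V D d n \<ge> \<tau> + \<epsilon> \<and> n \<in> H)"

definition p_fail ::
    "('a set \<Rightarrow> real) \<Rightarrow> 'a set \<Rightarrow> (nat \<Rightarrow> 'a) \<Rightarrow> nat \<Rightarrow> real \<Rightarrow> real \<Rightarrow> nat \<Rightarrow> real" where
  "p_fail V D d N \<tau> \<epsilon> T =
     measure_pmf.prob (tdshap V D d N \<tau> \<epsilon> T) {H. failure V D d N \<tau> \<epsilon> H}"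

end

theory Submission
  imports Defs
begin

text \<open>
  Write \<open>S\<close> for the centred sum of the samples of an index and \<open>c\<close> for their number, let
  \<open>w\<close> be the maximal range of the marginals and \<open>a = \<epsilon> \<surd>(T/(32N))\<close>. As long as \<open>\<bar>S\<bar> < a \<surd>c\<close>
  for all indices, the index of \<open>n\<close> differs from \<open>\<surd>c\<^sub>n (\<bar>\<phi>\<^sub>n - \<tau>\<bar> + \<epsilon>)\<close> by at most \<open>a\<close>, so choosing
  minimizers keeps these quantities balanced up to \<open>2a\<close>. By pigeonhole one of them reaches \<open>4a\<close>,
  hence all of them end above \<open>2a\<close>, and then every estimate is on the correct side of \<open>\<tau>\<close>.

  The probability that \<open>\<bar>S\<bar>\<close> ever reaches \<open>a \<surd>c\<close> is bounded on each block \<open>4\<^sup>u \<le> c \<le> 4\<^sup>u\<^sup>+\<^sup>1\<close> by the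
  probability of crossing the chord of \<open>a \<surd>c\<close>, i.e. by an exponential supermartingale from
  Hoeffding's lemma. Crude peeling, with the same boundary on a whole dyadic block, loses too much
  in the exponent for the stated constant. If \<open>w < \<epsilon>\<close> then failure is impossible; otherwise the budget
  condition forces \<open>T \<ge> 32N\<close>, which absorbs the factor 2 from the two signs.
\<close>

section \<open>Range and exponential moments of a single marginal\<close>

locale tdshap_setting =
  fixes D :: "'a set" and d :: "nat \<Rightarrow> 'a" and V :: "'a set \<Rightarrow> real"
    and N :: nat and \<tau> \<epsilon> :: real
  assumes N_pos: "N \<ge> 1"
    and bij: "bij_betw d {1..N} D"
    and eps_pos: "\<epsilon> > 0"
begin

abbreviation "P \<equiv> permutations_of_set D"
abbreviation "\<Phi> \<equiv> marginal V d"
abbreviation "\<phi> \<equiv> shapley V D d"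
abbreviation "w \<equiv> max_range V D d N"
abbreviation "steps \<equiv> tdshap_steps V D d N \<tau> \<epsilon>"

lemma finite_D [simp]: "finite D"
  using bij_betw_finite[OF bij] by simp

lemma set_pmf_perms [simp]: "set_pmf (pmf_of_set P) = P"
  by (rule set_pmf_of_set) auto

lemma card_perms: "real (card P) > 0"
  by (simp add: card_gt_0_iff)

lemma marginal_range:
  assumes "n \<in> {1..N}"
  obtains lo hi where "\<And>\<sigma>. \<sigma> \<in> P \<Longrightarrow> lo \<le> \<Phi> n \<sigma>" "\<And>\<sigma>. \<sigma> \<in> P \<Longrightarrow> \<Phi> n \<sigma> \<le> hi"
    "lo \<le> \<phi> n" "\<phi> n \<le> hi" "hi - lo \<le> w"
proof
  let ?lo = "MIN \<sigma>\<in>P. \<Phi> n \<sigma>" and ?hi = "MAX \<sigma>\<in>P. \<Phi> n \<sigma>"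
  show lo: "?lo \<le> \<Phi> n \<sigma>" and hi: "\<Phi> n \<sigma> \<le> ?hi" if "\<sigma> \<in> P" for \<sigma>
    using that by (auto intro: Min_le Max_ge)
  show "?lo \<le> \<phi> n"
    using sum_bounded_below[of P ?lo "\<Phi> n"] lo card_perms by (simp add: shapley_def pos_le_divide_eq mult.commute)
  show "\<phi> n \<le> ?hi"
    using sum_bounded_above[of P "\<Phi> n" ?hi] hi card_perms by (simp add: shapley_def pos_divide_le_eq mult.commute)
  show "?hi - ?lo \<le> w"
    unfolding max_range_def using assms by (intro Max_ge) auto
qed

text \<open>Hoeffding's lemma applies because \<open>\<phi> n\<close> is the mean of the marginal
  under a uniform ordering, so the centred marginal has expectation 0. The sign \<open>g\<close>
  selects the upper or lower tail.\<close>

lemma marginal_mgf: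
  assumes "n \<in> {1..N}" "g \<in> {1, -1}" "l > 0"
  shows "(\<integral>\<^sup>+\<sigma>. ennreal (exp (l * (g * (\<Phi> n \<sigma> - \<phi> n)))) \<partial>pmf_of_set P) \<le> ennreal (exp (l\<^sup>2 * w\<^sup>2 / 8))"
proof -
  obtain lo hi where range: "\<And>\<sigma>. \<sigma> \<in> P \<Longrightarrow> lo \<le> \<Phi> n \<sigma>" "\<And>\<sigma>. \<sigma> \<in> P \<Longrightarrow> \<Phi> n \<sigma> \<le> hi"
    "lo \<le> \<phi> n" "\<phi> n \<le> hi" "hi - lo \<le> w"
    using marginal_range[OF assms(1)] by blast
  \<comment> \<open>For \<open>g = -1\<close> the interval is reflected; in both cases its length is
    \<open>hi - lo\<close>.\<close>
  define A where "A = (if g = 1 then lo - \<phi> n else \<phi> n - hi)"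
  define B where "B = (if g = 1 then hi - \<phi> n else \<phi> n - lo)"
  let ?f = "\<lambda>\<sigma>. g * (\<Phi> n \<sigma> - \<phi> n)"
  interpret interval_bounded_random_variable "measure_pmf (pmf_of_set P)" ?f A B
    using assms(2) range by unfold_locales (auto simp: A_def B_def AE_measure_pmf_iff)
  have "(\<Sum>\<sigma>\<in>P. \<Phi> n \<sigma>) = real (card P) * \<phi> n"
    using card_perms by (simp add: shapley_def)
  then have "(\<Sum>\<sigma>\<in>P. ?f \<sigma>) = 0"
    by (simp add: sum_subtractf flip: sum_distrib_left)
  moreover have "measure_pmf.expectation (pmf_of_set P) ?f = (\<Sum>\<sigma>\<in>P. ?f \<sigma>) / real (card P)"
    by (rule integral_pmf_of_set) auto
  ultimately have "measure_pmf.expectation (pmf_of_set P) ?f = 0"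
    by simp
  then have "(\<integral>\<^sup>+\<sigma>. ennreal (exp (l * ?f \<sigma>)) \<partial>pmf_of_set P) \<le> ennreal (exp (l\<^sup>2 * (B - A)\<^sup>2 / 8))"
    using assms(3) by (intro Hoeffdings_lemma_nn_integral_0) auto
  also have "B - A = hi - lo"
    using assms(2) by (auto simp: A_def B_def)
  also have "ennreal (exp (l\<^sup>2 * (hi - lo)\<^sup>2 / 8)) \<le> ennreal (exp (l\<^sup>2 * w\<^sup>2 / 8))"
    using range by (intro ennreal_leI) (auto intro!: mult_left_mono power_mono)
  finally show ?thesis .
qed

section \<open>Reachable states and the case of a small range\<close>

lemma minimizers:
  "finite (tdshap_minimizers N \<tau> \<epsilon> s)" "tdshap_minimizers N \<tau> \<epsilon> s \<noteq> {}"
proof -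
  show "finite (tdshap_minimizers N \<tau> \<epsilon> s)"
    by (simp add: tdshap_minimizers_def)
  have "{1..N} \<noteq> {}" using N_pos by auto
  then obtain n where "is_arg_min (tdshap_index \<tau> \<epsilon> s) (\<lambda>n. n \<in> {1..N}) n"
    using ex_is_arg_min_if_finite[of "{1..N}" "tdshap_index \<tau> \<epsilon> s"] by auto
  then show "tdshap_minimizers N \<tau> \<epsilon> s \<noteq> {}"
    by (auto simp: tdshap_minimizers_def is_arg_min_linorder)
qed

lemma set_init:
  "s \<in> set_pmf (tdshap_init V D d N) \<longleftrightarrow>
    (\<exists>\<sigma>\<in>PiE_dflt {1..N} [] (\<lambda>_. P). s = (\<lambda>n. \<Phi> n (\<sigma> n), \<lambda>_. 1))"
  by (auto simp: tdshap_init_def set_Pi_pmf o_def)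

lemma set_step:
  "s' \<in> set_pmf (tdshap_step V D d N \<tau> \<epsilon> s) \<longleftrightarrow>
    (\<exists>n\<in>tdshap_minimizers N \<tau> \<epsilon> s. \<exists>\<sigma>\<in>P. s' = tdshap_update n (\<Phi> n \<sigma>) s)"
  by (auto simp: tdshap_step_def minimizers)

text \<open>An update replaces the estimate by a convex combination of itself and a new sample, so
  it cannot leave an interval that contains all samples.\<close>

lemma estimate_in_range:
  assumes "n \<in> {1..N}" and range: "\<And>\<sigma>. \<sigma> \<in> P \<Longrightarrow> \<Phi> n \<sigma> \<in> {lo..hi}"
    and "s \<in> set_pmf (steps t)"
  shows "fst s n \<in> {lo..hi}"
  using assms(3)
proof (induction t arbitrary: s)
  case 0
  then show ?case
    using assms(1) by (auto simp: set_init PiE_dflt_def simp del: atLeastAtMost_iff intro!: range)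
next
  case (Suc t)
  then obtain s0 m \<sigma> where s0: "s0 \<in> set_pmf (steps t)" "\<sigma> \<in> P"
    and s: "s = tdshap_update m (\<Phi> m \<sigma>) s0"
    by (auto simp: set_step)
  have IH: "fst s0 n \<in> {lo..hi}" using Suc.IH s0 by blast
  show ?case
  proof (cases "m = n")
    case True
    let ?c = "real (snd s0 n)"
    have "fst s n = (1 - 1 / (?c + 1)) * fst s0 n + 1 / (?c + 1) * \<Phi> n \<sigma>"
      using True by (simp add: s tdshap_update_def case_prod_unfold field_simps)
    moreover have "(1 - 1 / (?c + 1)) *\<^sub>R fst s0 n + (1 / (?c + 1)) *\<^sub>R \<Phi> n \<sigma> \<in> {lo..hi}"
      by (rule convexD_alt) (use IH range[OF s0(2)] in auto)
    ultimately show ?thesis by (simp only: real_scaleR_def)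
  next
    case False
    then show ?thesis using IH by (simp add: s tdshap_update_def case_prod_unfold)
  qed
qed

text \<open>Estimate and Shapley value lie in a common interval of length at most \<open>w\<close>,
  hence less than \<open>\<epsilon>\<close> apart.\<close>

lemma no_failure_if_range_small:
  assumes "w < \<epsilon>" "s \<in> set_pmf (steps t)"
  shows "\<not> failure V D d N \<tau> \<epsilon> {n \<in> {1..N}. fst s n \<le> \<tau>}"
proof -
  have "\<bar>fst s n - \<phi> n\<bar> < \<epsilon>" if n: "n \<in> {1..N}" for n
  proof -
    obtain lo hi where "\<And>\<sigma>. \<sigma> \<in> P \<Longrightarrow> lo \<le> \<Phi> n \<sigma>" "\<And>\<sigma>. \<sigma> \<in> P \<Longrightarrow> \<Phi> n \<sigma> \<le> hi"
      "lo \<le> \<phi> n" "\<phi> n \<le> hi" "hi - lo \<le> w"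
      using marginal_range[OF n] by blast
    moreover from this have "fst s n \<in> {lo..hi}"
      using assms(2) by (intro estimate_in_range[OF n]) auto
    ultimately show ?thesis using assms(1) by auto
  qed
  then show ?thesis by (force simp: failure_def)
qed

section \<open>Deterministic analysis of the selection rule\<close>

text \<open>As the estimate is the average of \<open>snd s n\<close> samples, this is the sum of the
  centred samples of \<open>n\<close>.\<close>

definition dev :: "nat \<Rightarrow> tdshap_state \<Rightarrow> real" where
  "dev n s = real (snd s n) * (fst s n - \<phi> n)"

text \<open>The second factor of \<open>tdshap_index\<close>, with the true value in place of the
  estimate.\<close>

definition gap :: "nat \<Rightarrow> real" where
  "gap n = \<bar>\<phi> n - \<tau>\<bar> + \<epsilon>"

definition good :: "real \<Rightarrow> tdshap_state \<Rightarrow> bool" where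
  "good a s \<longleftrightarrow> (\<forall>n\<in>{1..N}. \<bar>dev n s\<bar> < a * sqrt (real (snd s n)))"

text \<open>One evaluation of \<open>k\<close> is removed because the inequality arises when
  \<open>k\<close> is selected, before its count grows. Until \<open>k\<close> is selected again
  only the right-hand side can grow.\<close>

definition balanced :: "real \<Rightarrow> tdshap_state \<Rightarrow> bool" where
  "balanced a s \<longleftrightarrow> (\<forall>k\<in>{1..N}. \<forall>i\<in>{1..N}.
     sqrt (real (snd s k) - 1) * gap k \<le> sqrt (real (snd s i)) * gap i + 2 * a)"

definition counted :: "nat \<Rightarrow> tdshap_state \<Rightarrow> bool" where
  "counted t s \<longleftrightarrow> (\<forall>n\<in>{1..N}. 1 \<le> snd s n) \<and> (\<Sum>n\<in>{1..N}. snd s n) = N + t"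

lemma gap_ge: "gap n \<ge> \<epsilon>"
  by (simp add: gap_def)

lemma snd_update: "snd (tdshap_update n x s) m = snd s m + (if m = n then 1 else 0)"
  by (simp add: tdshap_update_def case_prod_unfold)

lemma dev_update: "dev m (tdshap_update n x s) = dev m s + (if m = n then x - \<phi> n else 0)"
  by (auto simp: dev_def tdshap_update_def case_prod_unfold add_nonneg_eq_0_iff field_simps)

lemma counted_update:
  assumes "counted t s" "n \<in> {1..N}"
  shows "counted (Suc t) (tdshap_update n x s)"
  using assms by (auto simp: counted_def snd_update sum.distrib sum.delta)

text \<open>By the reverse triangle inequality the error is at most
  \<open>\<bar>dev n s\<bar>\<close> divided by the root of the count, which \<open>good\<close>
  bounds by \<open>a\<close>.\<close>

lemma index_deviation:
  assumes "good a s" "counted t s" "n \<in> {1..N}"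
  shows "\<bar>tdshap_index \<tau> \<epsilon> s n - sqrt (real (snd s n)) * gap n\<bar> \<le> a"
proof -
  let ?r = "sqrt (real (snd s n))"
  have r: "?r > 0" using assms by (auto simp: counted_def Suc_le_eq)
  have "?r * \<bar>?r * (fst s n - \<phi> n)\<bar> = \<bar>dev n s\<bar>"
    by (simp add: dev_def abs_mult flip: mult.assoc)
  also have "\<dots> \<le> ?r * a"
    using assms by (auto simp: good_def mult.commute less_imp_le)
  finally have *: "\<bar>?r * (fst s n - \<phi> n)\<bar> \<le> a"
    using r by simp
  have "\<bar>tdshap_index \<tau> \<epsilon> s n - ?r * gap n\<bar> = ?r * \<bar>\<bar>fst s n - \<tau>\<bar> - \<bar>\<phi> n - \<tau>\<bar>\<bar>"
    using r by (simp add: tdshap_index_def gap_def case_prod_unfold abs_mult flip: right_diff_distrib)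
  also have "\<dots> \<le> ?r * \<bar>fst s n - \<phi> n\<bar>"
    using r by (intro mult_left_mono) auto
  finally show ?thesis using * r by (simp add: abs_mult)
qed

text \<open>Only the left-hand side of the selected index changes. Its observed index is minimal,
  and passing from observed to true values costs \<open>a\<close> on each side of the
  comparison.\<close>

lemma balanced_update:
  assumes "balanced a s" "good a s" "counted t s" "a \<ge> 0"
    and n: "n \<in> tdshap_minimizers N \<tau> \<epsilon> s"
  shows "balanced a (tdshap_update n x s)"
  unfolding balanced_def
proof (intro ballI)
  fix k i assume k: "k \<in> {1..N}" and i: "i \<in> {1..N}"
  let ?s = "tdshap_update n x s"
  have g: "gap i \<ge> 0" for i using gap_ge[of i] eps_pos by simp
  have "sqrt (real (snd ?s k) - 1) * gap k \<le> sqrt (real (snd s i)) * gap i + 2 * a"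
  proof (cases "k = n")
    case True
    have "tdshap_index \<tau> \<epsilon> s n \<le> tdshap_index \<tau> \<epsilon> s i"
      using n i by (simp add: tdshap_minimizers_def)
    then have "sqrt (real (snd s n)) * gap n \<le> sqrt (real (snd s i)) * gap i + 2 * a"
      using index_deviation[OF assms(2,3) i] index_deviation[OF assms(2,3) k] True
      by (simp add: abs_le_iff)
    then show ?thesis by (simp add: True snd_update)
  next
    case False
    then show ?thesis using assms(1) k i by (simp add: balanced_def snd_update)
  qed
  also have "sqrt (real (snd s i)) * gap i \<le> sqrt (real (snd ?s i)) * gap i"
    using g by (intro mult_right_mono) (auto simp: snd_update)
  finally show "sqrt (real (snd ?s k) - 1) * gap k \<le> sqrt (real (snd ?s i)) * gap i + 2 * a"
    by simp
qed

text \<open>Pigeonhole with weights: the counts without the initial evaluations sum to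
  \<open>t\<close>, while the proposed lower bounds sum to at most \<open>t\<close> because
  \<open>gap k \<ge> \<epsilon>\<close>.\<close>

lemma exists_heavy_index:
  assumes "counted t s"
  obtains k where "k \<in> {1..N}" "(real (snd s k) - 1) * (gap k)\<^sup>2 \<ge> real t * \<epsilon>\<^sup>2 / real N"
proof -
  have "\<exists>k\<in>{1..N}. real (snd s k) - 1 \<ge> real t * \<epsilon>\<^sup>2 / (real N * (gap k)\<^sup>2)"
  proof (rule ccontr)
    assume "\<not> ?thesis"
    then have "(\<Sum>k\<in>{1..N}. real (snd s k) - 1) < (\<Sum>k\<in>{1..N}. real t * \<epsilon>\<^sup>2 / (real N * (gap k)\<^sup>2))"
      using N_pos by (intro sum_strict_mono) (auto simp: not_le)
    also have "\<dots> \<le> (\<Sum>k\<in>{1..N}. real t / real N)"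
    proof (rule sum_mono)
      fix k
      have "\<epsilon>\<^sup>2 \<le> (gap k)\<^sup>2" "(gap k)\<^sup>2 > 0"
        using gap_ge[of k] eps_pos by (auto intro: power_mono)
      then show "real t * \<epsilon>\<^sup>2 / (real N * (gap k)\<^sup>2) \<le> real t / real N"
        using N_pos by (simp add: divide_simps mult_left_mono mult_right_mono)
    qed
    also have "\<dots> = real t" using N_pos by simp
    also have "real t = real (\<Sum>n\<in>{1..N}. snd s n) - real N"
      using assms by (simp add: counted_def)
    finally show False by (simp add: sum_subtractf)
  qed
  then obtain k where k: "k \<in> {1..N}"
    "real (snd s k) - 1 \<ge> real t * \<epsilon>\<^sup>2 / (real N * (gap k)\<^sup>2)" by blast
  have "(gap k)\<^sup>2 > 0" using gap_ge[of k] eps_pos by simp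
  with k N_pos show ?thesis by (intro that[of k]) (auto simp: field_simps)
qed

text \<open>A heavy index reaches \<open>4 * a\<close>, so balance leaves at least
  \<open>2 * a\<close> for every index. Since the deviation is below \<open>a\<close> on the same
  scale, each estimate errs by less than half its gap.\<close>

lemma no_failure_if_invariant:
  assumes "counted t s" "good a s" "balanced a s" "a \<ge> 0"
    and a: "16 * a\<^sup>2 \<le> real t * \<epsilon>\<^sup>2 / real N"
  shows "\<not> failure V D d N \<tau> \<epsilon> {n \<in> {1..N}. fst s n \<le> \<tau>}"
proof -
  have g: "gap i > 0" for i using gap_ge[of i] eps_pos by simp
  obtain k where k: "k \<in> {1..N}" "(real (snd s k) - 1) * (gap k)\<^sup>2 \<ge> real t * \<epsilon>\<^sup>2 / real N"
    using exists_heavy_index[OF assms(1)] .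
  have "4 * a = sqrt (16 * a\<^sup>2)" using assms(4) by (simp add: real_sqrt_mult)
  also have "\<dots> \<le> sqrt ((real (snd s k) - 1) * (gap k)\<^sup>2)"
    using k a by (intro real_sqrt_le_mono) linarith
  also have "\<dots> = sqrt (real (snd s k) - 1) * gap k"
    using g[of k] by (simp add: real_sqrt_mult)
  finally have heavy: "4 * a \<le> sqrt (real (snd s k) - 1) * gap k" .
  have "\<bar>fst s n - \<phi> n\<bar> < gap n / 2" if n: "n \<in> {1..N}" for n
  proof -
    let ?r = "sqrt (real (snd s n))"
    have r: "?r > 0" using assms(1) n by (auto simp: counted_def Suc_le_eq)
    have "2 * a \<le> ?r * gap n"
      using heavy assms(3) k(1) n by (force simp: balanced_def)
    moreover have "?r * \<bar>?r * (fst s n - \<phi> n)\<bar> = \<bar>dev n s\<bar>"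
      by (simp add: dev_def abs_mult flip: mult.assoc)
    moreover have "\<bar>dev n s\<bar> < ?r * a"
      using assms(2) n by (auto simp: good_def mult.commute)
    ultimately have "?r * \<bar>?r * (fst s n - \<phi> n)\<bar> < ?r * a" "a \<le> ?r * (gap n / 2)"
      by simp_all
    then have "\<bar>?r * (fst s n - \<phi> n)\<bar> < ?r * (gap n / 2)"
      using r by (simp only: mult_less_cancel_left_pos)
    then have "?r * \<bar>fst s n - \<phi> n\<bar> < ?r * (gap n / 2)"
      using r by (simp only: abs_mult abs_of_pos)
    then show ?thesis using r by (simp only: mult_less_cancel_left_pos)
  qed
  \<comment> \<open>Failure only concerns indices with
    \<open>\<bar>\<phi> n - \<tau>\<bar> \<ge> \<epsilon>\<close>, and for these
    \<open>gap n / 2 \<le> \<bar>\<phi> n - \<tau>\<bar>\<close>.\<close>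
  then have "(\<phi> n \<le> \<tau> - \<epsilon> \<longrightarrow> fst s n \<le> \<tau>) \<and> (\<tau> + \<epsilon> \<le> \<phi> n \<longrightarrow> \<tau> < fst s n)" if "n \<in> {1..N}" for n
    using that eps_pos by (fastforce simp: gap_def abs_if split: if_splits)
  then show ?thesis by (force simp: failure_def)
qed

section \<open>Exponential supermartingales for crossing a line\<close>

text \<open>For \<open>\<beta> > 0\<close> this is at least 1 once \<open>g * dev n s\<close>
  reaches the line with intercept \<open>\<alpha>\<close> and slope \<open>\<beta>\<close> in the
  count.\<close>

definition crossing :: "real \<Rightarrow> real \<Rightarrow> real \<Rightarrow> nat \<Rightarrow> tdshap_state \<Rightarrow> real" where
  "crossing \<alpha> \<beta> g n s = exp (8 * \<beta> / w\<^sup>2 * (g * dev n s - \<beta> * real (snd s n) - \<alpha>))"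

text \<open>The rate l = 8 \<beta> / w^2 solves l^2 w^2 / 8 = l \<beta>, so Hoeffding's bound is
  cancelled exactly by the drift.\<close>

lemma mgf_times_drift:
  assumes "n \<in> {1..N}" "g \<in> {1, -1}" "\<beta> > 0" "w > 0"
  shows "(\<integral>\<^sup>+\<sigma>. ennreal (exp (8 * \<beta> / w\<^sup>2 * (g * (\<Phi> n \<sigma> - \<phi> n) - \<beta>))) \<partial>pmf_of_set P) \<le> 1"
proof -
  let ?l = "8 * \<beta> / w\<^sup>2"
  have "ennreal (exp (?l * (g * (\<Phi> n \<sigma> - \<phi> n) - \<beta>)))
      = ennreal (exp (?l * (g * (\<Phi> n \<sigma> - \<phi> n)))) * ennreal (exp (- (?l * \<beta>)))" for \<sigma>
    by (simp add: right_diff_distrib exp_diff exp_minus divide_inverse flip: ennreal_mult')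
  then have "(\<integral>\<^sup>+\<sigma>. ennreal (exp (?l * (g * (\<Phi> n \<sigma> - \<phi> n) - \<beta>))) \<partial>pmf_of_set P)
      = (\<integral>\<^sup>+\<sigma>. ennreal (exp (?l * (g * (\<Phi> n \<sigma> - \<phi> n)))) \<partial>pmf_of_set P) * ennreal (exp (- (?l * \<beta>)))"
    by (simp add: nn_integral_multc)
  also have "\<dots> \<le> ennreal (exp (?l\<^sup>2 * w\<^sup>2 / 8)) * ennreal (exp (- (?l * \<beta>)))"
    using assms by (intro mult_right_mono marginal_mgf) auto
  also have "?l\<^sup>2 * w\<^sup>2 / 8 = ?l * \<beta>"
    using assms(4) by (simp add: field_simps power2_eq_square)
  finally show ?thesis
    by (simp add: exp_minus flip: ennreal_mult')
qed

text \<open>If \<open>m\<close> is sampled, the process gains an independent factor of mean at most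
  1; otherwise it does not move.\<close>

lemma crossing_step:
  assumes "n \<in> {1..N}" "g \<in> {1, -1}" "\<beta> > 0" "w > 0"
  shows "(\<integral>\<^sup>+\<sigma>. ennreal (crossing \<alpha> \<beta> g m (tdshap_update n (\<Phi> n \<sigma>) s)) \<partial>pmf_of_set P)
    \<le> ennreal (crossing \<alpha> \<beta> g m s)"
proof (cases "m = n")
  case True
  have "ennreal (crossing \<alpha> \<beta> g m (tdshap_update n (\<Phi> n \<sigma>) s))
      = ennreal (crossing \<alpha> \<beta> g m s) * ennreal (exp (8 * \<beta> / w\<^sup>2 * (g * (\<Phi> n \<sigma> - \<phi> n) - \<beta>)))" for \<sigma>
    unfolding crossing_def True dev_update snd_update
    by (subst ennreal_mult'[symmetric])
       (auto simp: algebra_simps add_divide_distrib diff_divide_distrib simp flip: exp_add)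
  then have "(\<integral>\<^sup>+\<sigma>. ennreal (crossing \<alpha> \<beta> g m (tdshap_update n (\<Phi> n \<sigma>) s)) \<partial>pmf_of_set P)
      = ennreal (crossing \<alpha> \<beta> g m s)
        * (\<integral>\<^sup>+\<sigma>. ennreal (exp (8 * \<beta> / w\<^sup>2 * (g * (\<Phi> n \<sigma> - \<phi> n) - \<beta>))) \<partial>pmf_of_set P)"
    by (simp add: nn_integral_cmult)
  also have "\<dots> \<le> ennreal (crossing \<alpha> \<beta> g m s) * 1"
    using assms by (intro mult_left_mono mgf_times_drift) auto
  finally show ?thesis by simp
next
  case False
  then show ?thesis
    by (simp add: crossing_def dev_update snd_update)
qed

text \<open>The initial sample contributes one such factor as well; what remains is the value at
  count 0 and deviation 0.\<close>

lemma crossing_init: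
  assumes "n \<in> {1..N}" "g \<in> {1, -1}" "\<beta> > 0" "w > 0"
  shows "(\<integral>\<^sup>+s. ennreal (crossing \<alpha> \<beta> g n s) \<partial>tdshap_init V D d N)
    \<le> ennreal (exp (- (8 * \<alpha> * \<beta> / w\<^sup>2)))"
proof -
  let ?f = "\<lambda>\<sigma>. ennreal (exp (8 * \<beta> / w\<^sup>2 * (g * (\<Phi> n \<sigma> - \<phi> n) - \<beta>)))"
  let ?c = "ennreal (exp (- (8 * \<alpha> * \<beta> / w\<^sup>2)))"
  let ?Q = "Pi_pmf {1..N} [] (\<lambda>_. pmf_of_set P)"
  have f: "ennreal (crossing \<alpha> \<beta> g n (\<lambda>n. \<Phi> n (\<sigma> n), \<lambda>_. 1)) = ?c * ?f (\<sigma> n)" for \<sigma>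
    unfolding crossing_def dev_def
    by (subst ennreal_mult'[symmetric])
       (auto simp: algebra_simps add_divide_distrib diff_divide_distrib simp flip: exp_add)
  have "(\<integral>\<^sup>+s. ennreal (crossing \<alpha> \<beta> g n s) \<partial>tdshap_init V D d N) = (\<integral>\<^sup>+\<sigma>. ?c * ?f (\<sigma> n) \<partial>?Q)"
    unfolding tdshap_init_def nn_integral_bind_pmf f[symmetric] by simp
  also have "\<dots> = ?c * (\<integral>\<^sup>+\<sigma>. ?f (\<sigma> n) \<partial>?Q)"
    by (simp add: nn_integral_cmult)
  also have "(\<integral>\<^sup>+\<sigma>. ?f (\<sigma> n) \<partial>?Q) = (\<integral>\<^sup>+\<sigma>. ?f \<sigma> \<partial>map_pmf (\<lambda>\<sigma>. \<sigma> n) ?Q)"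
    by simp
  also have "map_pmf (\<lambda>\<sigma>. \<sigma> n) ?Q = pmf_of_set P"
    using assms(1) by (simp add: Pi_pmf_component)
  also have "?c * (\<integral>\<^sup>+\<sigma>. ?f \<sigma> \<partial>pmf_of_set P) \<le> ?c * 1"
    using assms by (intro mult_left_mono mgf_times_drift) auto
  finally show ?thesis by simp
qed

text \<open>The components are an index, the exponent of a block of counts, and the sign of the
  tail.\<close>

definition blocks :: "nat \<Rightarrow> (nat \<times> nat \<times> real) set" where
  "blocks U = {1..N} \<times> {..U} \<times> {1, -1}"

text \<open>
  On \<open>[4\<^sup>u, 4\<^sup>u\<^sup>+\<^sup>1]\<close> the chord \<open>\<alpha> + \<beta> s\<close> of \<open>a \<surd>s\<close> has intercept \<open>2a2\<^sup>u/3\<close> and slope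
  \<open>a/(3\<cdot>2\<^sup>u)\<close>, so the product \<open>\<alpha>\<beta>\<close> does not depend on \<open>u\<close>.
\<close>

definition total :: "real \<Rightarrow> nat \<Rightarrow> tdshap_state \<Rightarrow> real" where
  "total a U s = (\<Sum>(n, u, g)\<in>blocks U. crossing (2 * a * 2 ^ u / 3) (a / (3 * 2 ^ u)) g n s)"

lemma ennreal_total:
  "ennreal (total a U s) =
    (\<Sum>(n, u, g)\<in>blocks U. ennreal (crossing (2 * a * 2 ^ u / 3) (a / (3 * 2 ^ u)) g n s))"
  unfolding total_def by (subst sum_ennreal[symmetric]) (auto simp: crossing_def case_prod_unfold)

lemma total_step:
  assumes "n \<in> {1..N}" "a > 0" "w > 0"
  shows "(\<integral>\<^sup>+\<sigma>. ennreal (total a U (tdshap_update n (\<Phi> n \<sigma>) s)) \<partial>pmf_of_set P) \<le> ennreal (total a U s)"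
  unfolding ennreal_total case_prod_unfold using assms
  by (subst nn_integral_sum) (auto simp: blocks_def intro!: sum_mono crossing_step)

text \<open>Intercept times slope is 2 a^2 / 9 on every block, so all 2 N (U + 1) summands have the
  same bound.\<close>

lemma total_init:
  assumes "a > 0" "w > 0"
  shows "(\<integral>\<^sup>+s. ennreal (total a U s) \<partial>tdshap_init V D d N)
    \<le> ennreal (2 * real N * (real U + 1) * exp (- (16 * a\<^sup>2 / (9 * w\<^sup>2))))"
proof -
  let ?e = "exp (- (16 * a\<^sup>2 / (9 * w\<^sup>2)))"
  have "(\<integral>\<^sup>+s. ennreal (total a U s) \<partial>tdshap_init V D d N)
    = (\<Sum>(n, u, g)\<in>blocks U. \<integral>\<^sup>+s. ennreal (crossing (2 * a * 2 ^ u / 3) (a / (3 * 2 ^ u)) g n s)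
        \<partial>tdshap_init V D d N)"
    unfolding ennreal_total case_prod_unfold by (rule nn_integral_sum) auto
  also have "\<dots> \<le> (\<Sum>(n, u, g)\<in>blocks U. ennreal ?e)"
    unfolding case_prod_unfold
  proof (rule sum_mono)
    fix p assume "p \<in> blocks U"
    then have "fst p \<in> {1..N}" "snd (snd p) \<in> {1, -1}" by (auto simp: blocks_def)
    from crossing_init[OF this, of "a / (3 * 2 ^ fst (snd p))" "2 * a * 2 ^ fst (snd p) / 3"] assms
    show "(\<integral>\<^sup>+s. ennreal (crossing (2 * a * 2 ^ fst (snd p) / 3) (a / (3 * 2 ^ fst (snd p)))
        (snd (snd p)) (fst p) s) \<partial>tdshap_init V D d N) \<le> ennreal ?e"
      by (simp add: power2_eq_square)
  qed
  also have "\<dots> = ennreal (2 * real N * (real U + 1) * ?e)"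
    by (simp add: blocks_def card_cartesian_product case_prod_unfold ennreal_of_nat_eq_real_of_nat
        algebra_simps flip: ennreal_mult')
  finally show ?thesis .
qed

text \<open>The count of an offending index lies in some block with \<open>u \<le> U\<close>. There
  the concave square root is above its chord, so the chord is crossed too and the matching summand
  is at least 1.\<close>

lemma total_ge_1:
  assumes "\<not> good a s" "counted t s" "N + t < 4 ^ Suc U" "a > 0" "w > 0"
  shows "total a U s \<ge> 1"
proof -
  obtain n where n: "n \<in> {1..N}" "\<bar>dev n s\<bar> \<ge> a * sqrt (real (snd s n))"
    using assms(1) by (auto simp: good_def not_less)
  let ?c = "snd s n"
  have "?c \<ge> 1" using assms(2) n by (simp add: counted_def)
  have "?c \<le> (\<Sum>n\<in>{1..N}. snd s n)" using n by (intro member_le_sum) auto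
  then have "?c < 4 ^ Suc U" using assms(2,3) by (simp add: counted_def)
  moreover obtain u where u: "4 ^ u \<le> ?c" "?c < 4 ^ (u + 1)"
    using ex_power_ivl1[of 4 ?c] \<open>?c \<ge> 1\<close> by auto
  ultimately have "4 ^ u < (4::nat) ^ Suc U" by linarith
  then have "u \<le> U" by (simp del: power_Suc add: less_Suc_eq_le)
  define r where "r = (2::real) ^ u"
  define q where "q = sqrt (real ?c)"
  have r: "r > 0" "r\<^sup>2 = 4 ^ u"
    by (simp_all add: r_def power2_eq_square flip: power_mult_distrib)
  have q: "q \<ge> 0" "q\<^sup>2 = real ?c" by (simp_all add: q_def)
  have "real (4 ^ u) \<le> real ?c" "real ?c \<le> real (4 ^ (u + 1))"
    using u by (simp_all only: of_nat_le_iff less_imp_le)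
  then have "r\<^sup>2 \<le> q\<^sup>2" "q\<^sup>2 \<le> (2 * r)\<^sup>2"
    by (simp_all add: r q power_mult_distrib)
  then have "r \<le> q" "q \<le> 2 * r"
    using r(1) q(1) by (simp_all only: power2_le_imp_le less_imp_le mult_nonneg_nonneg zero_le_numeral)
  \<comment> \<open>The chord inequality: the root \<open>q\<close> of the count lies between the
    roots \<open>r\<close> and \<open>2 * r\<close> of the endpoints.\<close>
  then have "(q - r) * (2 * r - q) \<ge> 0" by simp
  then have chord: "q\<^sup>2 + 2 * r\<^sup>2 \<le> 3 * r * q" by (simp add: algebra_simps power2_eq_square)
  define g :: real where "g = (if dev n s \<ge> 0 then 1 else -1)"
  have "a / (3 * r) * real ?c + 2 * a * r / 3 = a / (3 * r) * (q\<^sup>2 + 2 * r\<^sup>2)"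
    using r(1) q(2) by (simp add: field_simps power2_eq_square)
  also have "\<dots> \<le> a / (3 * r) * (3 * r * q)"
    using chord r(1) assms(4) by (intro mult_left_mono) auto
  also have "\<dots> = a * q" using r(1) by simp
  also have "\<dots> \<le> g * dev n s" using n(2) by (auto simp: g_def q_def)
  finally have "1 \<le> crossing (2 * a * 2 ^ u / 3) (a / (3 * 2 ^ u)) g n s"
    using assms(4) by (auto simp: crossing_def r_def intro!: mult_nonneg_nonneg)
  also have "\<dots> = (\<lambda>(n, u, g). crossing (2 * a * 2 ^ u / 3) (a / (3 * 2 ^ u)) g n s) (n, u, g)"
    by simp
  also have "\<dots> \<le> total a U s"
    unfolding total_def using n \<open>u \<le> U\<close>
    by (intro member_le_sum) (auto simp: blocks_def g_def crossing_def)
  finally show ?thesis .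
qed

section \<open>Probability of violating the invariant\<close>

definition invariant :: "real \<Rightarrow> nat \<Rightarrow> tdshap_state \<Rightarrow> bool" where
  "invariant a t s \<longleftrightarrow> counted t s \<and> good a s \<and> balanced a s"

text \<open>
  Charging 1 for every state that violates the invariant turns the probability of a violation at
  any time into a supermartingale bound, without recording the history of the run.
\<close>

definition charge :: "real \<Rightarrow> nat \<Rightarrow> nat \<Rightarrow> tdshap_state \<Rightarrow> ennreal" where
  "charge a U t s = (if invariant a t s then min 1 (ennreal (total a U s)) else 1)"

text \<open>From an invariant state the successors stay counted and balanced, so a violation means
  that \<open>good\<close> fails and \<open>total\<close> is at least 1. Thus the new charge is
  below \<open>total\<close>, a supermartingale. From other states the bound 1 suffices.\<close>

lemma charge_step:
  assumes "N + Suc t < 4 ^ Suc U" "a > 0" "w > 0"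
  shows "(\<integral>\<^sup>+s'. charge a U (Suc t) s' \<partial>tdshap_step V D d N \<tau> \<epsilon> s) \<le> charge a U t s"
proof -
  have le1: "(\<integral>\<^sup>+s'. charge a U (Suc t) s' \<partial>tdshap_step V D d N \<tau> \<epsilon> s) \<le> 1"
    by (intro measure_pmf.nn_integral_le_const AE_I2) (simp_all add: charge_def)
  show ?thesis
  proof (cases "invariant a t s")
    case True
    have le: "charge a U (Suc t) (tdshap_update n x s) \<le> ennreal (total a U (tdshap_update n x s))"
      if n: "n \<in> tdshap_minimizers N \<tau> \<epsilon> s" for n x
    proof (cases "invariant a (Suc t) (tdshap_update n x s)")
      case True
      then show ?thesis by (simp add: charge_def)
    next
      case False
      have c: "counted (Suc t) (tdshap_update n x s)"
        using True n by (intro counted_update) (auto simp: invariant_def tdshap_minimizers_def)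
      moreover have "balanced a (tdshap_update n x s)"
        using True n assms by (intro balanced_update) (auto simp: invariant_def)
      ultimately have "\<not> good a (tdshap_update n x s)"
        using False by (simp add: invariant_def)
      from total_ge_1[OF this c assms] False show ?thesis
        by (simp add: charge_def)
    qed
    have "(\<integral>\<^sup>+s'. charge a U (Suc t) s' \<partial>tdshap_step V D d N \<tau> \<epsilon> s)
      = (\<integral>\<^sup>+n. \<integral>\<^sup>+\<sigma>. charge a U (Suc t) (tdshap_update n (\<Phi> n \<sigma>) s) \<partial>pmf_of_set P
          \<partial>pmf_of_set (tdshap_minimizers N \<tau> \<epsilon> s))"
      by (simp add: tdshap_step_def)
    also have "\<dots> \<le> ennreal (total a U s)"
    proof (intro measure_pmf.nn_integral_le_const)
      show "AE n in pmf_of_set (tdshap_minimizers N \<tau> \<epsilon> s).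
        (\<integral>\<^sup>+\<sigma>. charge a U (Suc t) (tdshap_update n (\<Phi> n \<sigma>) s) \<partial>pmf_of_set P) \<le> ennreal (total a U s)"
      proof (rule AE_pmfI)
        fix n assume "n \<in> set_pmf (pmf_of_set (tdshap_minimizers N \<tau> \<epsilon> s))"
        then have n: "n \<in> tdshap_minimizers N \<tau> \<epsilon> s" by (simp add: minimizers)
        then have "n \<in> {1..N}" by (simp add: tdshap_minimizers_def)
        from total_step[OF this assms(2,3)]
        show "(\<integral>\<^sup>+\<sigma>. charge a U (Suc t) (tdshap_update n (\<Phi> n \<sigma>) s) \<partial>pmf_of_set P)
            \<le> ennreal (total a U s)"
          by (rule order.trans[OF nn_integral_mono, rotated]) (rule le[OF n])
      qed
    qed simp
    finally show ?thesis using True le1 by (simp add: charge_def)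
  next
    case False
    then show ?thesis using le1 by (simp add: charge_def)
  qed
qed

text \<open>All counts are 1, so the left-hand sides in \<open>balanced\<close> vanish and only
  \<open>good\<close> can fail.\<close>

lemma charge_init:
  assumes "N < 4 ^ Suc U" "a > 0" "w > 0" "s \<in> set_pmf (tdshap_init V D d N)"
  shows "charge a U 0 s \<le> ennreal (total a U s)"
proof (cases "invariant a 0 s")
  case True
  then show ?thesis by (simp add: charge_def)
next
  case False
  have cnt: "snd s n = 1" for n using assms(4) by (auto simp: set_init)
  then have c: "counted 0 s" by (simp add: counted_def)
  moreover have "gap n \<ge> 0" for n using gap_ge[of n] eps_pos by simp
  then have "balanced a s" using assms(2) cnt by (auto simp: balanced_def)
  ultimately have "\<not> good a s" using False by (simp add: invariant_def)
  from total_ge_1[OF this c _ assms(2,3)] assms(1) False show ?thesis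
    by (simp add: charge_def)
qed

lemma charge_steps:
  assumes "N + t < 4 ^ Suc U" "a > 0" "w > 0"
  shows "(\<integral>\<^sup>+s. charge a U t s \<partial>steps t)
    \<le> ennreal (2 * real N * (real U + 1) * exp (- (16 * a\<^sup>2 / (9 * w\<^sup>2))))"
  using assms(1)
proof (induction t)
  case 0
  have "(\<integral>\<^sup>+s. charge a U 0 s \<partial>steps 0) \<le> (\<integral>\<^sup>+s. ennreal (total a U s) \<partial>tdshap_init V D d N)"
    using 0 assms(2,3) by (auto intro!: nn_integral_mono_AE AE_pmfI charge_init)
  then show ?case using total_init[OF assms(2,3), of U] by (rule order.trans)
next
  case (Suc t)
  have "(\<integral>\<^sup>+s. charge a U (Suc t) s \<partial>steps (Suc t)) \<le> (\<integral>\<^sup>+s. charge a U t s \<partial>steps t)"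
    using charge_step[OF Suc.prems assms(2,3)] by (auto intro!: nn_integral_mono)
  also have "\<dots> \<le> ennreal (2 * real N * (real U + 1) * exp (- (16 * a\<^sup>2 / (9 * w\<^sup>2))))"
    using Suc by simp
  finally show ?case .
qed

lemma prob_violation:
  assumes "N + t < 4 ^ Suc U" "a > 0" "w > 0"
  shows "measure_pmf.prob (steps t) {s. \<not> invariant a t s}
    \<le> 2 * real N * (real U + 1) * exp (- (16 * a\<^sup>2 / (9 * w\<^sup>2)))"
proof -
  have "emeasure (steps t) {s. \<not> invariant a t s}
      = (\<integral>\<^sup>+s. indicator {s. \<not> invariant a t s} s \<partial>steps t)"
    by simp
  also have "\<dots> \<le> (\<integral>\<^sup>+s. charge a U t s \<partial>steps t)"
    by (intro nn_integral_mono) (simp add: charge_def indicator_def)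
  also have "\<dots> \<le> ennreal (2 * real N * (real U + 1) * exp (- (16 * a\<^sup>2 / (9 * w\<^sup>2))))"
    by (rule charge_steps[OF assms])
  finally show ?thesis
    by (simp add: measure_pmf.emeasure_eq_measure)
qed

section \<open>Bounds on the failure probability\<close>

lemma p_fail_eq:
  "p_fail V D d N \<tau> \<epsilon> T =
    measure_pmf.prob (steps (T - N)) {s. failure V D d N \<tau> \<epsilon> {n \<in> {1..N}. fst s n \<le> \<tau>}}"
  by (simp add: p_fail_def tdshap_def case_prod_unfold vimage_def)

lemma p_fail_zero_if_range_small:
  assumes "w < \<epsilon>"
  shows "p_fail V D d N \<tau> \<epsilon> T = 0"
  unfolding p_fail_eq
  by (rule measure_pmf.prob_eq_0[THEN iffD2])
     (use no_failure_if_range_small[OF assms] in \<open>auto simp: AE_measure_pmf_iff\<close>)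

lemma p_fail_le:
  assumes "2 * N \<le> T" "T < 4 ^ Suc U" "w > 0"
  shows "p_fail V D d N \<tau> \<epsilon> T
    \<le> 2 * real N * (real U + 1) * exp (- (real T * \<epsilon>\<^sup>2 / (18 * real N * w\<^sup>2)))"
proof -
  \<comment> \<open>Then 16 a^2 = T \<epsilon>^2 / (2 N), which is at most (T - N) \<epsilon>^2 / N
    because T \<ge> 2 N, as the pigeonhole argument requires.\<close>
  define a where "a = sqrt (real T * \<epsilon>\<^sup>2 / (32 * real N))"
  have T: "real T > 0" "real N > 0" using assms(1) N_pos by auto
  have a: "a > 0" "a\<^sup>2 = real T * \<epsilon>\<^sup>2 / (32 * real N)"
    using T eps_pos by (simp_all add: a_def)
  have "16 * a\<^sup>2 = (real T / 2) * \<epsilon>\<^sup>2 / real N" by (simp add: a)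
  also have "\<dots> \<le> real (T - N) * \<epsilon>\<^sup>2 / real N"
    using assms(1) by (intro divide_right_mono mult_right_mono) (auto simp: of_nat_diff)
  finally have "\<not> failure V D d N \<tau> \<epsilon> {n \<in> {1..N}. fst s n \<le> \<tau>}" if "invariant a (T - N) s" for s
    using no_failure_if_invariant[of "T - N" s a] that a(1) by (simp add: invariant_def)
  then have "p_fail V D d N \<tau> \<epsilon> T \<le> measure_pmf.prob (steps (T - N)) {s. \<not> invariant a (T - N) s}"
    unfolding p_fail_eq by (intro measure_pmf.finite_measure_mono) auto
  also have "\<dots> \<le> 2 * real N * (real U + 1) * exp (- (16 * a\<^sup>2 / (9 * w\<^sup>2)))"
    using assms a(1) by (intro prob_violation) auto
  also have "16 * a\<^sup>2 / (9 * w\<^sup>2) = real T * \<epsilon>\<^sup>2 / (18 * real N * w\<^sup>2)"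
    by (simp add: a)
  finally show ?thesis .
qed

end

section \<open>Numerical consequences of the budget condition\<close>

text \<open>The hypothesis is the budget condition at its weakest for
  \<open>w \<ge> \<epsilon>\<close>, namely \<open>w = \<epsilon>\<close>. It is used to bootstrap:
  ln T \<ge> 2/3 yields T \<ge> 32 N, and then ln T \<ge> 5 ln 2 \<ge> 3.\<close>

lemma budget_lower_bounds:
  assumes "N \<ge> 1" "T \<ge> 2" "real T \<ge> 64 * real N * ln (real N * (1 + ln (real T)))"
  shows "2 * N \<le> T" "real N * (1 + ln (real T)) \<ge> 4"
proof -
  have "ln 2 \<le> ln (real T)"
    using assms(2) by (intro ln_mono) auto
  then have ln2: "ln (real T) \<ge> 2 / 3"
    using ln2_ge_two_thirds by simp
  \<comment> \<open>Enough that e < 2.72 < 25/9; the value 5/3 is 1 plus the lower bound for ln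
    T.\<close>
  have "exp (1 / 2 :: real) * exp (1 / 2) \<le> 5 / 3 * (5 / 3)"
    using e_less_272 by (simp flip: exp_add)
  then have "exp (1 / 2) \<le> (5 / 3 :: real)"
    by (metis abs_exp_cancel abs_le_square_iff abs_numeral abs_divide power2_eq_square)
  also have "(5 / 3 :: real) \<le> 1 * (1 + ln (real T))" using ln2 by simp
  also have "\<dots> \<le> real N * (1 + ln (real T))"
    using assms(1) ln2 by (intro mult_right_mono) auto
  finally have "ln (exp (1 / 2)) \<le> ln (real N * (1 + ln (real T)))"
    by (intro ln_mono) auto
  then have "64 * real N * (1 / 2) \<le> 64 * real N * ln (real N * (1 + ln (real T)))"
    by (intro mult_left_mono) auto
  then have T: "32 * real N \<le> real T" using assms(3) by simp
  then show "2 * N \<le> T" by linarith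
  have "ln (2 ^ 5) \<le> ln (real T)" using T assms(1) by (intro ln_mono) auto
  then have "3 \<le> ln (real T)"
    using ln2_ge_two_thirds ln_realpow[of "2::real" 5] by simp
  then have "1 * 4 \<le> real N * (1 + ln (real T))"
    using assms(1) by (intro mult_mono) auto
  then show "real N * (1 + ln (real T)) \<ge> 4" by simp
qed

text \<open>Take the largest power of 4 not exceeding \<open>T\<close> and use ln 4 \<ge> 1.\<close>

lemma obtain_block_count:
  assumes "T \<ge> 1"
  obtains U where "T < 4 ^ Suc U" "real U \<le> ln (real T)"
proof -
  obtain U where U: "4 ^ U \<le> T" "T < 4 ^ (U + 1)"
    using ex_power_ivl1[of 4 T] assms by auto
  have "1 \<le> ln (4::real)"
    using ln2_ge_two_thirds ln_realpow[of 2 2] by simp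
  then have "real U \<le> real U * ln 4" by (simp add: mult_le_cancel_left1)
  also have "\<dots> = ln (4 ^ U)" by (simp add: ln_realpow)
  also have "\<dots> \<le> ln (real T)" using U(1) by (intro ln_mono) (auto simp flip: of_nat_le_iff)
  finally show ?thesis using U(2) that[of U] by simp
qed

theorem theorem2:
  fixes D :: "'a set" and d :: "nat \<Rightarrow> 'a" and V :: "'a set \<Rightarrow> real"
    and N T :: nat and \<tau> \<epsilon> :: real
  assumes "N \<ge> 1"
    and "bij_betw d {1..N} D"
    and "\<epsilon> > 0"
    and "T \<ge> N"
    and "real T \<ge> 64 * real N * (max_range V D d N)\<^sup>2 / \<epsilon>\<^sup>2 * ln (real N * (1 + ln (real T)))"
  shows "p_fail V D d N \<tau> \<epsilon> T \<le> 1 / ((real N)\<^sup>2 * (1 + ln (real T))\<^sup>2)"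
proof -
  interpret tdshap_setting D d V N \<tau> \<epsilon>
    using assms by unfold_locales
  define x where "x = real N * (1 + ln (real T))"
  have bound: "1 / ((real N)\<^sup>2 * (1 + ln (real T))\<^sup>2) = 1 / x\<^sup>2"
    by (simp add: x_def power_mult_distrib)
  have "1 * 1 \<le> x" unfolding x_def using assms(1,4) by (intro mult_mono) auto
  then have x1: "x \<ge> 1" by simp
  \<comment> \<open>\<open>T = 1\<close> forces \<open>N = 1\<close>, where the claimed bound is the
    trivial 1.\<close>
  consider "w < \<epsilon>" | "T = 1" | "w \<ge> \<epsilon>" "T \<ge> 2" using assms(1,4) by linarith
  then have "p_fail V D d N \<tau> \<epsilon> T \<le> 1 / x\<^sup>2"
  proof cases
    case 1
    then show ?thesis by (simp add: p_fail_zero_if_range_small)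
  next
    case 2
    then have "x = 1" using assms(1,4) by (simp add: x_def)
    then show ?thesis by (simp add: p_fail_def)
  next
    case 3
    then have w: "w > 0" using assms(3) by simp
    have "64 * real N * 1 * ln x \<le> 64 * real N * (w\<^sup>2 / \<epsilon>\<^sup>2) * ln x"
      using 3 assms(3) x1 by (intro mult_right_mono mult_left_mono) (auto intro!: power_mono)
    also have "\<dots> \<le> real T" using assms(5) by (simp add: x_def)
    finally have "2 * N \<le> T" and x4: "x \<ge> 4"
      using budget_lower_bounds[OF assms(1) 3(2)] by (simp_all add: x_def)
    have "T \<ge> 1" using 3 by simp
    then obtain U where U: "T < 4 ^ Suc U" "real U \<le> ln (real T)"
      using obtain_block_count by blast
    have "ln (4::real) \<le> ln x" using x4 by (intro ln_mono) auto
    then have L: "2 * ln 2 \<le> ln x" using ln_realpow[of "2::real" 2] by simp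
    \<comment> \<open>The constant is 64/18.\<close>
    have "32 / 9 * ln x \<le> real T * \<epsilon>\<^sup>2 / (18 * real N * w\<^sup>2)"
      using assms(1,3,5) w by (simp add: x_def field_simps)
    \<comment> \<open>As x \<ge> 4, ln 2 is at most half of ln x, and 3/2 - 32/9 = -37/18 <
      -2.\<close>
    moreover have "ln 2 + ln x - 32 / 9 * ln x \<le> - 2 * ln x" using L ln_gt_zero[of x] x4 by linarith
    ultimately have "ln 2 + ln x - real T * \<epsilon>\<^sup>2 / (18 * real N * w\<^sup>2) \<le> - 2 * ln x" by linarith
    then have *: "exp (ln 2 + ln x - real T * \<epsilon>\<^sup>2 / (18 * real N * w\<^sup>2)) \<le> exp (- 2 * ln x)" by simp
    have "p_fail V D d N \<tau> \<epsilon> T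
        \<le> 2 * real N * (real U + 1) * exp (- (real T * \<epsilon>\<^sup>2 / (18 * real N * w\<^sup>2)))"
      by (rule p_fail_le[OF \<open>2 * N \<le> T\<close> U(1) w])
    \<comment> \<open>The number of blocks satisfies U + 1 \<le> 1 + ln T.\<close>
    also have "\<dots> \<le> 2 * x * exp (- (real T * \<epsilon>\<^sup>2 / (18 * real N * w\<^sup>2)))"
      unfolding x_def using U(2) by (simp add: mult_left_mono)
    also have "\<dots> = exp (ln 2 + ln x - real T * \<epsilon>\<^sup>2 / (18 * real N * w\<^sup>2))"
      using x4 by (simp add: exp_add exp_diff exp_minus field_simps)
    also note *
    also have "exp (- 2 * ln x) = 1 / x\<^sup>2"
      using x4 by (simp add: exp_minus exp_double inverse_eq_divide)
    finally show ?thesis .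
  qed
  then show ?thesis by (simp only: bound)
qed

end
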